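(* Let $G$ be a finite group of order $m$ and exponent $3$, and let $K$ be a field. Then the Leavitt path algebra $L_K(Pow^{\ast}(G))$ of the punctured power digraph of $G$ is isomorphic to the direct sum of $\frac{m-1}{2}$ copies of $M_2(K[x,x^{-1}])$.
   Context: The exponent of a group is the least common multiple of the orders of its elements. The power digraph $Pow(G)$ of a group $G$ has the elements of $G$ as vertices, with exactly one directed edge from $x$ to $y$ whenever $x\neq y$ and $y=x^m$ for some integer $m$ (and no other edges). The punctured power digraph $Pow^{\ast}(G)$ is obtained from $Pow(G)$ by deleting the vertex corresponding to the identity element (and all edges incident to it). For a directed graph $E=(E^0,E^1,r,s)$ ($r$ and $s$ are the range and source maps) and a field $K$, the Leavitt path algebra $L_K(E)$ is the free associative $K$-algebra generated by $E^0\cup E^1\cup (E^1)^{\ast}$, where $(E^1)^{\ast}=\{e^{\ast}: e\in E^1\}$, subject to the relations: (V) $vv'=\delta_{v,v'}v$ for $v,v'\in E^0$; (E1) $s(e)e=er(e)=e$ for $e\in E^1$; (E2) $r(e)e^{\ast}=e^{\ast}s(e)=e^{\ast}$ for $e\in E^1$; (CK1) $e^{\ast}e'=\delta_{e,e'}r(e)$ for $e,e'\in E^1$; (CK2) $v=\sum_{e\in E^1,\, s(e)=v}ee^{\ast}$ for every regular vertex $v$, i.e. every vertex $v$ with $0<|s^{-1}(v)|<\infty$. $K[x,x^{-1}]$ is the Laurent polynomial ring and $M_2(R)$ the ring of $2\times2$ matrices over $R$. *)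

theory Defs
  imports
    "HOL-Algebra.QuotRing"
    "HOL-Algebra.Module"
    "HOL-Algebra.Multiplicative_Group"
    "HOL-Library.Poly_Mapping"
    "Graph_Theory.Digraph_Component"
    "Jordan_Normal_Form.Matrix"
begin

definition group_exponent :: "('a, 'b) monoid_scheme \<Rightarrow> nat" where
  "group_exponent G = Lcm (group.ord G ` carrier G)"

definition power_digraph :: "('a, 'b) monoid_scheme \<Rightarrow> ('a, 'a \<times> 'a) pre_digraph" where
  "power_digraph G =
     \<lparr>verts = carrier G,
      arcs = {(x, y). x \<in> carrier G \<and> y \<in> carrier G \<and> x \<noteq> y \<and> (\<exists>k::int. y = x [^]\<^bsub>G\<^esub> k)},
      tail = fst, head = snd\<rparr>"

definition punctured_power_digraph :: "('a, 'b) monoid_scheme \<Rightarrow> ('a, 'a \<times> 'a) pre_digraph" where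
  "punctured_power_digraph G = pre_digraph.del_vert (power_digraph G) \<one>\<^bsub>G\<^esub>"

text \<open>The ground field is a type \<open>'k\<close> of class \<open>field\<close>; a \<open>'k\<close>-algebra is a record of type
  \<open>('k, 'a) module\<close>, which carries a multiplication as well as the scalar action. The
  locale \<open>algebra\<close> is not used because it is restricted to commutative algebras.\<close>

definition alg_isomorphic ::
    "('k, 'a, 'm) module_scheme \<Rightarrow> ('k, 'b, 'n) module_scheme \<Rightarrow> bool" where
  "alg_isomorphic A B \<longleftrightarrow>
     (\<exists>h \<in> ring_iso A B. \<forall>c. \<forall>x \<in> carrier A. h (c \<odot>\<^bsub>A\<^esub> x) = c \<odot>\<^bsub>B\<^esub> h x)"

text \<open>The entry \<open>one\<close> below lies in the carrier only if the index set is finite (or almost all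
  summands are zero); otherwise the direct sum is not unital and \<open>one\<close> has no meaning.\<close>

definition alg_direct_sum ::
    "'i set \<Rightarrow> ('i \<Rightarrow> ('k, 'a, 'm) module_scheme) \<Rightarrow> ('k, 'i \<Rightarrow> 'a) module" where
  "alg_direct_sum I A =
     \<lparr>carrier = {f \<in> (\<Pi>\<^sub>E i\<in>I. carrier (A i)). finite {i \<in> I. f i \<noteq> \<zero>\<^bsub>A i\<^esub>}},
      monoid.mult = (\<lambda>f g. \<lambda>i\<in>I. f i \<otimes>\<^bsub>A i\<^esub> g i),
      one = (\<lambda>i\<in>I. \<one>\<^bsub>A i\<^esub>),
      zero = (\<lambda>i\<in>I. \<zero>\<^bsub>A i\<^esub>),
      add = (\<lambda>f g. \<lambda>i\<in>I. f i \<oplus>\<^bsub>A i\<^esub> g i),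
      smult = (\<lambda>c f. \<lambda>i\<in>I. c \<odot>\<^bsub>A i\<^esub> f i)\<rparr>"

text \<open>Laurent polynomials are the group algebra of the integers: \<open>Poly_Mapping.single n c\<close> is
  \<open>c x\<^sup>n\<close>, and multiplication is the convolution product.\<close>

type_synonym 'k laurent_poly = "int \<Rightarrow>\<^sub>0 'k"

definition laurent_mat_algebra ::
    "'k::field itself \<Rightarrow> nat \<Rightarrow> ('k, 'k laurent_poly mat) module" where
  "laurent_mat_algebra _ n =
     ring_mat TYPE('k laurent_poly) n (module.fields (\<lambda>c. map_mat (Poly_Mapping.map ((*) c))))"

text \<open>Words form a monoid under concatenation; writing it additively makes the convolution
  product on \<open>'g list \<Rightarrow>\<^sub>0 'k\<close> the multiplication of noncommutative polynomials.\<close>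

instantiation list :: (type) monoid_add
begin

definition zero_list :: "'a list" where "zero_list = []"

definition plus_list :: "'a list \<Rightarrow> 'a list \<Rightarrow> 'a list" where "plus_list = (@)"

instance
  by standard (simp_all add: zero_list_def plus_list_def)

end

definition free_algebra :: "'g set \<Rightarrow> ('k::field, 'g list \<Rightarrow>\<^sub>0 'k) module" where
  "free_algebra X =
     \<lparr>carrier = {p. Poly_Mapping.keys p \<subseteq> lists X},
      monoid.mult = (*), one = 1, zero = 0, add = (+),
      smult = (\<lambda>c. Poly_Mapping.map ((*) c))\<rparr>"

lemma ring_free_algebra: "ring (free_algebra X :: ('k::field, 'g list \<Rightarrow>\<^sub>0 'k) module)"
proof (rule ringI)
  let ?F = "free_algebra X :: ('k, 'g list \<Rightarrow>\<^sub>0 'k) module"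
  show "abelian_group ?F"
  proof (rule abelian_groupI)
    fix x y assume "x \<in> carrier ?F" "y \<in> carrier ?F"
    then show "x \<oplus>\<^bsub>?F\<^esub> y \<in> carrier ?F"
      using Poly_Mapping.keys_add[of x y] by (auto simp: free_algebra_def)
  next
    fix x assume "x \<in> carrier ?F"
    then have "- x \<in> carrier ?F" "- x \<oplus>\<^bsub>?F\<^esub> x = \<zero>\<^bsub>?F\<^esub>"
      by (auto simp: free_algebra_def in_keys_iff)
    then show "\<exists>y\<in>carrier ?F. y \<oplus>\<^bsub>?F\<^esub> x = \<zero>\<^bsub>?F\<^esub>" by blast
  qed (auto simp: free_algebra_def algebra_simps)
  show "Group.monoid ?F"
  proof (rule monoidI)
    fix x y assume "x \<in> carrier ?F" "y \<in> carrier ?F"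
    then show "x \<otimes>\<^bsub>?F\<^esub> y \<in> carrier ?F"
      using keys_mult[of x y] by (fastforce simp: free_algebra_def plus_list_def)
  qed (auto simp: free_algebra_def algebra_simps zero_list_def)
qed (auto simp: free_algebra_def algebra_simps)

datatype ('v, 'e) lpa_gen = Vertex 'v | Edge 'e | Ghost 'e

definition lpa_gens :: "('v, 'e) pre_digraph \<Rightarrow> ('v, 'e) lpa_gen set" where
  "lpa_gens E = Vertex ` verts E \<union> Edge ` arcs E \<union> Ghost ` arcs E"

abbreviation gen :: "'g \<Rightarrow> 'g list \<Rightarrow>\<^sub>0 'k::field" where
  "gen x \<equiv> Poly_Mapping.single [x] 1"

text \<open>A relation \<open>a = b\<close> is represented by \<open>a - b\<close>. The source map is \<^const>\<open>tail\<close>, the range map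
  is \<^const>\<open>head\<close>, and \<^const>\<open>out_arcs\<close> \<open>E v\<close> is \<open>s\<^sup>-\<^sup>1(v)\<close>.\<close>

inductive_set lpa_relations ::
    "('v, 'e) pre_digraph \<Rightarrow> (('v, 'e) lpa_gen list \<Rightarrow>\<^sub>0 'k::field) set"
  for E :: "('v, 'e) pre_digraph" where
  V: "\<lbrakk>v \<in> verts E; w \<in> verts E\<rbrakk> \<Longrightarrow>
        gen (Vertex v) * gen (Vertex w) - (if v = w then gen (Vertex v) else 0) \<in> lpa_relations E"
| E1_source: "e \<in> arcs E \<Longrightarrow>
        gen (Vertex (tail E e)) * gen (Edge e) - gen (Edge e) \<in> lpa_relations E"
| E1_range: "e \<in> arcs E \<Longrightarrow>
        gen (Edge e) * gen (Vertex (head E e)) - gen (Edge e) \<in> lpa_relations E"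
| E2_range: "e \<in> arcs E \<Longrightarrow>
        gen (Vertex (head E e)) * gen (Ghost e) - gen (Ghost e) \<in> lpa_relations E"
| E2_source: "e \<in> arcs E \<Longrightarrow>
        gen (Ghost e) * gen (Vertex (tail E e)) - gen (Ghost e) \<in> lpa_relations E"
| CK1: "\<lbrakk>e \<in> arcs E; f \<in> arcs E\<rbrakk> \<Longrightarrow>
        gen (Ghost e) * gen (Edge f) - (if e = f then gen (Vertex (head E e)) else 0)
          \<in> lpa_relations E"
| CK2: "\<lbrakk>v \<in> verts E; finite (out_arcs E v); out_arcs E v \<noteq> {}\<rbrakk> \<Longrightarrow>
        gen (Vertex v) - (\<Sum>e\<in>out_arcs E v. gen (Edge e) * gen (Ghost e)) \<in> lpa_relations E"

lemma lpa_relations_subset: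
  fixes E :: "('v, 'e) pre_digraph"
  assumes "wf_digraph E"
  shows "(lpa_relations E :: (('v, 'e) lpa_gen list \<Rightarrow>\<^sub>0 'k::field) set) \<subseteq>
    {p \<in> carrier (free_algebra (lpa_gens E)). Poly_Mapping.lookup p [] = 0}"
proof -
  interpret wf_digraph E by fact
  define A :: "(('v, 'e) lpa_gen list \<Rightarrow>\<^sub>0 'k) set"
    where "A = {p \<in> carrier (free_algebra (lpa_gens E)). Poly_Mapping.lookup p [] = 0}"
  have gen: "gen x \<in> A" if "x \<in> lpa_gens E" for x
    using that by (auto simp: A_def free_algebra_def lookup_single)
  have gen2: "gen x * gen y \<in> A" if "x \<in> lpa_gens E" "y \<in> lpa_gens E" for x y
    using that by (auto simp: A_def free_algebra_def mult_single plus_list_def lookup_single)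
  have zero: "0 \<in> A" by (auto simp: A_def free_algebra_def)
  have diff: "p - q \<in> A" if "p \<in> A" "q \<in> A" for p q
  proof -
    have "Poly_Mapping.keys (p - q) \<subseteq> Poly_Mapping.keys p \<union> Poly_Mapping.keys q"
      by (auto simp: in_keys_iff lookup_minus)
    with that show ?thesis by (simp add: A_def free_algebra_def lookup_minus) blast
  qed
  have sum: "sum f S \<in> A" if "\<And>e. e \<in> S \<Longrightarrow> f e \<in> A" for f and S :: "'e set"
    using that
  proof (induction S rule: infinite_finite_induct)
    case (insert x S)
    then have "f x - (0 - sum f S) \<in> A" by (intro diff zero) auto
    with insert show ?case by simp
  qed (use zero in auto)
  have "p \<in> A" if "p \<in> lpa_relations E" for p
    using that
    by cases (auto intro!: diff gen gen2 zero sum simp: lpa_gens_def)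
  then show ?thesis by (auto simp: A_def)
qed

definition lpa_ideal ::
    "('v, 'e) pre_digraph \<Rightarrow> (('v, 'e) lpa_gen list \<Rightarrow>\<^sub>0 'k::field) set" where
  "lpa_ideal E = Idl\<^bsub>free_algebra (lpa_gens E)\<^esub> (lpa_relations E)"

text \<open>The free associative algebra in the definition of a Leavitt path algebra is the non-unital
  one, spanned by the nonempty words: adjoining the empty word would add a spurious identity to
  the quotient. It is the augmentation ideal of \<^const>\<open>free_algebra\<close>. For a well-formed digraph
  the relations lie in it (\<open>lpa_relations_subset\<close>), so the two-sided ideal they generate in the
  unital free algebra is also the one they generate in the augmentation ideal. For a finite
  vertex set the quotient is unital with identity the sum of the vertices; for an infinite one
  the entry \<open>one\<close> has no meaning.\<close>

definition leavitt_path_algebra ::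
    "'k::field itself \<Rightarrow> ('v, 'e) pre_digraph \<Rightarrow>
      ('k, (('v, 'e) lpa_gen list \<Rightarrow>\<^sub>0 'k) set) module" where
  "leavitt_path_algebra _ E =
     (let F = free_algebra (lpa_gens E); I = lpa_ideal E in
      \<lparr>carrier = {I +>\<^bsub>F\<^esub> p | p. p \<in> carrier F \<and> Poly_Mapping.lookup p [] = 0},
       monoid.mult = rcoset_mult F I,
       one = I +>\<^bsub>F\<^esub> (\<Sum>v\<in>verts E. gen (Vertex v)),
       zero = I,
       add = set_add F,
       smult = (\<lambda>c A. \<Union>a\<in>A. I +>\<^bsub>F\<^esub> (c \<odot>\<^bsub>F\<^esub> a))\<rparr>)"

end

theory Submission
  imports Defs
begin

text \<open>The nontrivial powers of a nonidentity element \<open>x\<close> in a group of exponent 3 are \<open>x\<close> and its inverse,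
  and these are distinct. So the punctured power digraph is a disjoint union of \<open>(m - 1) / 2\<close> directed
  cycles of length two, one for each pair \<open>{x, x\<^sup>-\<^sup>1}\<close>
  (\<open>arcs_punctured_power_digraph_exponent_3\<close>, \<open>inverse_pairs\<close>).

  It remains to identify the Leavitt path algebra of a disjoint union of finitely many cycles of length
  \<open>c\<close> with a sum of matrix algebras \<open>M\<^sub>c(K[x, x\<^sup>-\<^sup>1])\<close> (\<open>leavitt_path_algebra_iso\<close>). Each vertex emits
  one edge, so (CK1) and (CK2) make every edge invertible with its ghost edge as the inverse. Nonzero
  words therefore behave like walks on the unrolled cycle, a line with integer positions: modulo the
  relations, a walk depends only on its two ends (\<open>word_eq_normal_form\<close>).

  A walk from position \<open>a < c\<close> to position \<open>c q + b\<close> with \<open>b < c\<close> is sent to the matrix with \<open>x\<^sup>q\<close> at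
  \<open>(a, b)\<close>. This is multiplicative because walks commute with the shift by \<open>c\<close> (\<open>entry_mult\<close>), and it
  respects the relations (\<open>lpa_relations_annihilated\<close>). Sending \<open>x\<^sup>q\<close> at \<open>(a, b)\<close> back to the reduced
  path from \<open>a\<close> to \<open>c q + b\<close> inverts it: one composite is the identity on matrices (\<open>rep_lift\<close>), and
  the other is reduction to normal form, which is congruent to the identity
  (\<open>rep_eq_0_imp_in_lpa_ideal\<close>).\<close>

section \<open>Linear extension\<close>

abbreviation scaled :: "'k::field \<Rightarrow> ('b \<Rightarrow>\<^sub>0 'k) \<Rightarrow> ('b \<Rightarrow>\<^sub>0 'k)" where
  "scaled c \<equiv> Poly_Mapping.map ((*) c)"

lemma lookup_scaled [simp]: "Poly_Mapping.lookup (scaled c p) k = c * Poly_Mapping.lookup p k"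
  by (simp add: Poly_Mapping.map.rep_eq when_def)

lemma scaled_simps [simp]:
  "scaled c 0 = 0" "scaled 0 p = 0" "scaled 1 p = p"
  "scaled c (Poly_Mapping.single k d) = Poly_Mapping.single k (c * d)"
  by (rule poly_mapping_eqI, simp add: lookup_single when_def)+

lemma scaled_scaled: "scaled c (scaled d p) = scaled (c * d) p"
  by (rule poly_mapping_eqI) (simp add: mult.assoc)

lemma scaled_add: "scaled c (p + q) = scaled c p + scaled c q"
  by (rule poly_mapping_eqI) (simp add: lookup_add distrib_left)

lemma scaled_diff: "scaled c (p - q) = scaled c p - scaled c q"
  by (rule poly_mapping_eqI) (simp add: lookup_minus right_diff_distrib)

lemma scaled_add_left: "scaled (c + d) p = scaled c p + scaled d p"
  by (rule poly_mapping_eqI) (simp add: lookup_add distrib_right)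

lemma scaled_sum: "scaled c (sum f A) = (\<Sum>x\<in>A. scaled c (f x))"
  by (rule poly_mapping_eqI) (simp add: lookup_sum sum_distrib_left)

text \<open>The linear extension of a map on a basis. It serves three purposes below: the entries of a
  representation of the free algebra are extended from words, the inverse of that representation is
  extended from monomials, and rewriting of words into normal form is extended to polynomials.\<close>
definition lin_ext :: "('a \<Rightarrow> ('b \<Rightarrow>\<^sub>0 'k::field)) \<Rightarrow> ('a \<Rightarrow>\<^sub>0 'k) \<Rightarrow> ('b \<Rightarrow>\<^sub>0 'k)" where
  "lin_ext f p = (\<Sum>k\<in>Poly_Mapping.keys p. scaled (Poly_Mapping.lookup p k) (f k))"

text \<open>Any finite superset of the support may be used, so that two elements can be compared over a common
  index set; this is what makes the extension additive.\<close>
lemma lin_ext_superset: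
  assumes "finite A" "Poly_Mapping.keys p \<subseteq> A"
  shows "lin_ext f p = (\<Sum>k\<in>A. scaled (Poly_Mapping.lookup p k) (f k))"
  unfolding lin_ext_def using assms
  by (intro sum.mono_neutral_left) (auto simp: in_keys_iff)

lemma lin_ext_0 [simp]: "lin_ext f 0 = 0"
  by (simp add: lin_ext_def)

lemma lin_ext_single [simp]: "lin_ext f (Poly_Mapping.single k c) = scaled c (f k)"
  by (simp add: lin_ext_superset[of "{k}"])

lemma lin_ext_add: "lin_ext f (p + q) = lin_ext f p + lin_ext f q"
proof -
  have "Poly_Mapping.keys (p + q) \<subseteq> Poly_Mapping.keys p \<union> Poly_Mapping.keys q"
    by (rule Poly_Mapping.keys_add)
  then show ?thesis
    by (simp add: lin_ext_superset[of "Poly_Mapping.keys p \<union> Poly_Mapping.keys q"] lookup_add scaled_add_left sum.distrib)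
qed

lemma lin_ext_scaled: "lin_ext f (scaled c p) = scaled c (lin_ext f p)"
proof -
  have "Poly_Mapping.keys (scaled c p) \<subseteq> Poly_Mapping.keys p"
    by (auto simp: in_keys_iff)
  then show ?thesis
    by (simp add: lin_ext_superset[of "Poly_Mapping.keys p"] scaled_sum scaled_scaled)
qed

lemma lin_ext_diff: "lin_ext f (p - q) = lin_ext f p - lin_ext f q"
  using lin_ext_add[of f "p - q" q] by (simp add: algebra_simps)

lemma lin_ext_sum: "lin_ext f (sum g A) = (\<Sum>x\<in>A. lin_ext f (g x))"
  by (induction A rule: infinite_finite_induct) (simp_all add: lin_ext_add)

lemma lin_ext_lin_ext: "lin_ext g (lin_ext f p) = lin_ext (\<lambda>k. lin_ext g (f k)) p"
  by (simp add: lin_ext_def[of f] lin_ext_def[of "\<lambda>k. lin_ext g (f k)"] lin_ext_sum lin_ext_scaled)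

lemma lin_ext_fun_sum: "lin_ext (\<lambda>k. \<Sum>x\<in>A. f x k) p = (\<Sum>x\<in>A. lin_ext (f x) p)"
  unfolding lin_ext_def scaled_sum by (rule sum.swap)

lemma lin_ext_single_1: "lin_ext (\<lambda>k. Poly_Mapping.single k 1) p = p"
  by (rule poly_mapping_eqI)
    (simp add: lin_ext_def lookup_sum lookup_single when_def in_keys_iff)

lemma poly_mapping_linear_induct [case_names 0 single add]:
  assumes "P 0" "\<And>k c. P (Poly_Mapping.single k c)" "\<And>p q. P p \<Longrightarrow> P q \<Longrightarrow> P (p + q)"
  shows "P (p :: 'a \<Rightarrow>\<^sub>0 'k::field)"
proof -
  have "P (\<Sum>k\<in>A. Poly_Mapping.single k (Poly_Mapping.lookup p k))" for A
    by (induction A rule: infinite_finite_induct) (simp_all add: assms)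
  from this[of "Poly_Mapping.keys p"] show ?thesis
    using lin_ext_single_1[of p] by (simp add: lin_ext_def)
qed

lemma scaled_eq_mult: "scaled c p = Poly_Mapping.single 0 c * (p :: 'b::monoid_add \<Rightarrow>\<^sub>0 'k::field)"
  by (induction p rule: poly_mapping_linear_induct) (simp_all add: mult_single scaled_add distrib_left)

lemma scaled_mult_left: "scaled c p * q = scaled c (p * q)"
  for p q :: "'b::monoid_add \<Rightarrow>\<^sub>0 'k::field"
  by (simp add: scaled_eq_mult mult.assoc)

lemma scaled_mult_right: "p * scaled c q = scaled c (p * q)"
  for p q :: "'b::monoid_add \<Rightarrow>\<^sub>0 'k::field"
proof (induction p rule: poly_mapping_linear_induct)
  case (single k d)
  show ?case
  proof (induction q rule: poly_mapping_linear_induct)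
    case (single l e)
    show ?case by (simp add: mult_single mult.left_commute)
  qed (simp_all add: distrib_left scaled_add)
qed (simp_all add: distrib_right scaled_add)

text \<open>A family that multiplies like matrices on a monoid still does so on the monoid algebra, because both
  sides are bilinear. Matrices are given here by their entries, indexed by \<open>A\<close>.\<close>
lemma lin_ext_matrix_mult:
  fixes f :: "'i \<Rightarrow> 'i \<Rightarrow> 'a::monoid_add \<Rightarrow> ('b::monoid_add \<Rightarrow>\<^sub>0 'k::field)"
  assumes "\<And>u w. f a b (u + w) = (\<Sum>k\<in>A. f a k u * f k b w)"
  shows "lin_ext (f a b) (p * q) = (\<Sum>k\<in>A. lin_ext (f a k) p * lin_ext (f k b) q)"
proof (induction p rule: poly_mapping_linear_induct)
  case (single u c)
  show ?case
  proof (induction q rule: poly_mapping_linear_induct)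
    case (single w d)
    show ?case
      by (simp add: mult_single assms scaled_mult_left scaled_mult_right scaled_sum
          scaled_scaled mult.commute[of c d])
  qed (simp_all add: distrib_left lin_ext_add sum.distrib)
qed (simp_all add: distrib_right lin_ext_add sum.distrib)

section \<open>Ideals and cosets in the free algebra\<close>

abbreviation word :: "'g list \<Rightarrow> 'g list \<Rightarrow>\<^sub>0 'k::field" where
  "word w \<equiv> Poly_Mapping.single w 1"

lemma word_append: "word (u @ w) = word u * word w"
  by (simp add: mult_single plus_list_def)

lemma carrier_free_algebra: "p \<in> carrier (free_algebra X) \<longleftrightarrow> Poly_Mapping.keys p \<subseteq> lists X"
  by (simp add: free_algebra_def)

lemma word_in_free_algebra [simp]: "word w \<in> carrier (free_algebra X) \<longleftrightarrow> w \<in> lists X"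
  by (simp add: carrier_free_algebra)

lemma free_algebra_ops:
  "x \<otimes>\<^bsub>free_algebra X\<^esub> y = x * y" "x \<oplus>\<^bsub>free_algebra X\<^esub> y = x + y"
  "\<one>\<^bsub>free_algebra X\<^esub> = 1" "\<zero>\<^bsub>free_algebra X\<^esub> = 0" "c \<odot>\<^bsub>free_algebra X\<^esub> x = scaled c x"
  by (simp_all add: free_algebra_def)

lemma free_algebra_closed:
  assumes "p \<in> carrier (free_algebra X)" "q \<in> carrier (free_algebra X)"
  shows "p + q \<in> carrier (free_algebra X)" "p * q \<in> carrier (free_algebra X)"
    "p - q \<in> carrier (free_algebra X)" "scaled c p \<in> carrier (free_algebra X)"
proof -
  interpret ring "free_algebra X :: ('b, 'a list \<Rightarrow>\<^sub>0 'b) module" by (rule ring_free_algebra)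
  show "p + q \<in> carrier (free_algebra X)" "p * q \<in> carrier (free_algebra X)"
    using a_closed[OF assms] m_closed[OF assms] by (simp_all add: free_algebra_ops)
  show "p - q \<in> carrier (free_algebra X)"
    using assms Poly_Mapping.keys_diff[of p q] by (auto simp: carrier_free_algebra dest!: subsetD)
  show "scaled c p \<in> carrier (free_algebra X)"
    using assms(1) by (auto simp: carrier_free_algebra in_keys_iff dest!: subsetD)
qed

text \<open>Scaling is multiplication by a constant polynomial, so two-sided ideals are also linear subspaces.\<close>
lemma free_algebra_ideal_closed:
  fixes J :: "('g list \<Rightarrow>\<^sub>0 'k::field) set"
  assumes "ideal J (free_algebra X)"
  shows "0 \<in> J" "p \<in> J \<Longrightarrow> p \<in> carrier (free_algebra X)"
    "p \<in> J \<Longrightarrow> r \<in> carrier (free_algebra X) \<Longrightarrow> r * p \<in> J"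
    "p \<in> J \<Longrightarrow> r \<in> carrier (free_algebra X) \<Longrightarrow> p * r \<in> J"
    "p \<in> J \<Longrightarrow> q \<in> J \<Longrightarrow> p + q \<in> J" "p \<in> J \<Longrightarrow> scaled c p \<in> J" "p \<in> J \<Longrightarrow> q \<in> J \<Longrightarrow> p - q \<in> J"
proof -
  interpret ideal J "free_algebra X :: ('k, 'g list \<Rightarrow>\<^sub>0 'k) module" by fact
  note ops = free_algebra_ops[where X = X]
  show "0 \<in> J" using additive_subgroup.zero_closed[OF is_additive_subgroup] by (simp add: ops)
  show "p \<in> carrier (free_algebra X)" if "p \<in> J" for p using that by (rule a_Hcarr)
  show l: "r * p \<in> J" if "p \<in> J" "r \<in> carrier (free_algebra X)" for p r
    using I_l_closed[OF that] by (simp add: ops)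
  show "p * r \<in> J" if "p \<in> J" "r \<in> carrier (free_algebra X)" for p r
    using I_r_closed[OF that] by (simp add: ops)
  show a: "p + q \<in> J" if "p \<in> J" "q \<in> J" for p q
    using additive_subgroup.a_closed[OF is_additive_subgroup that] by (simp add: ops)
  show s: "scaled c p \<in> J" if "p \<in> J" for c p
    unfolding scaled_eq_mult using that by (rule l) (auto simp: carrier_free_algebra zero_list_def)
  show "p - q \<in> J" if "p \<in> J" "q \<in> J" for p q
  proof -
    have "p - q = p + scaled (- 1) q"
      by (rule poly_mapping_eqI) (simp add: lookup_add lookup_minus)
    then show ?thesis using a[OF that(1) s[OF that(2)]] by (simp only:)
  qed
qed

lemma free_algebra_coset_mem:
  fixes J :: "('g list \<Rightarrow>\<^sub>0 'k::field) set"
  shows "x \<in> J +>\<^bsub>free_algebra X\<^esub> y \<longleftrightarrow> x - y \<in> J"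
proof
  assume "x - y \<in> J"
  moreover have "x = (x - y) + y" by simp
  ultimately show "x \<in> J +>\<^bsub>free_algebra X\<^esub> y"
    unfolding a_r_coset_def' free_algebra_ops by blast
qed (auto simp: a_r_coset_def' free_algebra_ops)

lemma free_algebra_coset_eq_iff:
  fixes J :: "('g list \<Rightarrow>\<^sub>0 'k::field) set"
  assumes "ideal J (free_algebra X)"
  shows "J +>\<^bsub>free_algebra X\<^esub> p = J +>\<^bsub>free_algebra X\<^esub> q \<longleftrightarrow> p - q \<in> J"
proof -
  note cl = free_algebra_ideal_closed[OF assms]
  note mem = free_algebra_coset_mem[where J = J and X = X]
  show ?thesis
  proof
    assume eq: "J +>\<^bsub>free_algebra X\<^esub> p = J +>\<^bsub>free_algebra X\<^esub> q"
    have "p \<in> J +>\<^bsub>free_algebra X\<^esub> p" by (simp add: mem cl(1))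
    then show "p - q \<in> J" unfolding eq mem .
  next
    assume pq: "p - q \<in> J"
    have "x - p \<in> J \<longleftrightarrow> x - q \<in> J" for x
      using cl(5)[of "x - p" "p - q"] cl(7)[of "x - q" "p - q"] pq by auto
    then show "J +>\<^bsub>free_algebra X\<^esub> p = J +>\<^bsub>free_algebra X\<^esub> q"
      by (auto simp: mem)
  qed
qed

section \<open>Congruence of noncommutative polynomials in a Leavitt path algebra\<close>

context wf_digraph
begin

lemma ideal_lpa_ideal: "ideal (lpa_ideal G) (free_algebra (lpa_gens G))"
  unfolding lpa_ideal_def using lpa_relations_subset[OF wf_digraph_axioms]
  by (intro ring.genideal_ideal ring_free_algebra) auto

lemmas lpa_ideal_closed = free_algebra_ideal_closed[OF ideal_lpa_ideal]

lemma lpa_relations_in_ideal: "p \<in> lpa_relations G \<Longrightarrow> p \<in> lpa_ideal G"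
  unfolding lpa_ideal_def using lpa_relations_subset[OF wf_digraph_axioms]
  by (intro subsetD[OF ring.genideal_self[OF ring_free_algebra]]) auto

text \<open>Equality in the Leavitt path algebra, as a congruence on the free algebra.\<close>
definition lpa_eq ::
    "(('a, 'b) lpa_gen list \<Rightarrow>\<^sub>0 'k::field) \<Rightarrow> (('a, 'b) lpa_gen list \<Rightarrow>\<^sub>0 'k) \<Rightarrow> bool"
    (infix "\<approx>" 50) where
  "p \<approx> q \<longleftrightarrow> p - q \<in> lpa_ideal G"

lemma lpa_eq_refl [simp]: "p \<approx> p"
  by (simp add: lpa_eq_def lpa_ideal_closed)

lemma lpa_eq_sym: "p \<approx> q \<Longrightarrow> q \<approx> p"
  using lpa_ideal_closed(7)[of 0 "p - q"] by (simp add: lpa_eq_def lpa_ideal_closed)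

lemma lpa_eq_trans [trans]: "p \<approx> q \<Longrightarrow> q \<approx> r \<Longrightarrow> p \<approx> r"
  using lpa_ideal_closed(5)[of "p - q" "q - r"] by (simp add: lpa_eq_def)

lemma lpa_eq_add: "p \<approx> q \<Longrightarrow> p' \<approx> q' \<Longrightarrow> p + p' \<approx> q + q'"
  using lpa_ideal_closed(5)[of "p - q" "p' - q'"] by (simp add: lpa_eq_def algebra_simps)

lemma lpa_eq_sum: "(\<And>x. x \<in> A \<Longrightarrow> f x \<approx> g x) \<Longrightarrow> sum f A \<approx> sum g A"
  by (induction A rule: infinite_finite_induct) (simp_all add: lpa_eq_add)

lemma lpa_eq_scaled: "p \<approx> q \<Longrightarrow> scaled c p \<approx> scaled c q"
  by (simp add: lpa_eq_def lpa_ideal_closed flip: scaled_diff)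

lemma lpa_eq_mult_left:
  "p \<approx> q \<Longrightarrow> r \<in> carrier (free_algebra (lpa_gens G)) \<Longrightarrow> r * p \<approx> r * q"
  by (simp add: lpa_eq_def lpa_ideal_closed flip: right_diff_distrib)

lemma lpa_eq_mult_right:
  "p \<approx> q \<Longrightarrow> r \<in> carrier (free_algebra (lpa_gens G)) \<Longrightarrow> p * r \<approx> q * r"
  by (simp add: lpa_eq_def lpa_ideal_closed flip: left_diff_distrib)

text \<open>A ghost edge is read backwards, so it starts at the head of its edge and ends at the tail. With this
  convention (V), (E1) and (E2) together say that every generator absorbs the vertex where it starts
  from the left and the vertex where it ends from the right, and is annihilated there by all others.\<close>
fun gen_src :: "('a, 'b) lpa_gen \<Rightarrow> 'a" where
  "gen_src (Vertex v) = v"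
| "gen_src (Edge e) = tail G e"
| "gen_src (Ghost e) = head G e"

fun gen_tgt :: "('a, 'b) lpa_gen \<Rightarrow> 'a" where
  "gen_tgt (Vertex v) = v"
| "gen_tgt (Edge e) = head G e"
| "gen_tgt (Ghost e) = tail G e"

lemma gen_ends_in_verts:
  "x \<in> lpa_gens G \<Longrightarrow> gen_src x \<in> verts G" "x \<in> lpa_gens G \<Longrightarrow> gen_tgt x \<in> verts G"
  by (auto simp: lpa_gens_def)

lemma in_lpa_gens [simp]:
  "Vertex v \<in> lpa_gens G \<longleftrightarrow> v \<in> verts G" "Edge e \<in> lpa_gens G \<longleftrightarrow> e \<in> arcs G"
  "Ghost e \<in> lpa_gens G \<longleftrightarrow> e \<in> arcs G"
  by (auto simp: lpa_gens_def)

lemma vertices_orthogonal: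
  "v \<in> verts G \<Longrightarrow> w \<in> verts G \<Longrightarrow> v \<noteq> w \<Longrightarrow> gen (Vertex v) * gen (Vertex w) \<approx> 0"
  using lpa_relations_in_ideal[OF lpa_relations.V[of v G w]] by (simp add: lpa_eq_def)

lemma gen_src_left:
  assumes "x \<in> lpa_gens G" shows "gen (Vertex (gen_src x)) * gen x \<approx> gen x"
proof (cases x)
  case (Vertex v)
  then show ?thesis
    using assms lpa_relations_in_ideal[OF lpa_relations.V[of v G v]] by (simp add: lpa_eq_def)
next
  case (Edge e)
  then show ?thesis
    using assms lpa_relations_in_ideal[OF lpa_relations.E1_source[of e]] by (simp add: lpa_eq_def)
next
  case (Ghost e)
  then show ?thesis
    using assms lpa_relations_in_ideal[OF lpa_relations.E2_range[of e]] by (simp add: lpa_eq_def)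
qed

lemma gen_tgt_right:
  assumes "x \<in> lpa_gens G" shows "gen x * gen (Vertex (gen_tgt x)) \<approx> gen x"
proof (cases x)
  case (Vertex v)
  then show ?thesis
    using assms lpa_relations_in_ideal[OF lpa_relations.V[of v G v]] by (simp add: lpa_eq_def)
next
  case (Edge e)
  then show ?thesis
    using assms lpa_relations_in_ideal[OF lpa_relations.E1_range[of e]] by (simp add: lpa_eq_def)
next
  case (Ghost e)
  then show ?thesis
    using assms lpa_relations_in_ideal[OF lpa_relations.E2_source[of e]] by (simp add: lpa_eq_def)
qed

lemma vertex_mult_gen_eq_0:
  assumes "v \<in> verts G" "x \<in> lpa_gens G" "v \<noteq> gen_src x"
  shows "gen (Vertex v) * gen x \<approx> 0"
proof -
  have "gen (Vertex v) * gen x \<approx> gen (Vertex v) * (gen (Vertex (gen_src x)) * gen x)"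
    using assms by (intro lpa_eq_mult_left lpa_eq_sym[OF gen_src_left]) auto
  also have "\<dots> = gen (Vertex v) * gen (Vertex (gen_src x)) * gen x"
    by (simp only: mult.assoc)
  also have "\<dots> \<approx> 0 * gen x"
    using assms by (intro lpa_eq_mult_right vertices_orthogonal gen_ends_in_verts) auto
  finally show ?thesis by simp
qed

lemma word_end_vertex:
  assumes "w \<in> lists (lpa_gens G)" "w \<noteq> []"
  shows "word w * gen (Vertex (gen_tgt (last w))) \<approx> word w"
proof -
  from assms(2) obtain u x where w: "w = u @ [x]" by (cases w rule: rev_cases) auto
  show ?thesis
    using assms(1) unfolding w word_append mult.assoc
    by (intro lpa_eq_mult_left) (auto intro: gen_tgt_right)
qed

lemma word_mult_gen_eq_0:
  assumes "w \<in> lists (lpa_gens G)" "w \<noteq> []" "x \<in> lpa_gens G" "gen_tgt (last w) \<noteq> gen_src x"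
  shows "word w * gen x \<approx> 0"
proof -
  let ?v = "gen_tgt (last w)"
  have v: "?v \<in> verts G" using assms gen_ends_in_verts(2)[of "last w"] by auto
  have "word w * gen x \<approx> word w * gen (Vertex ?v) * gen x"
    using assms by (intro lpa_eq_mult_right lpa_eq_sym[OF word_end_vertex]) auto
  also have "\<dots> = word w * (gen (Vertex ?v) * gen x)"
    by (simp only: mult.assoc)
  also have "\<dots> \<approx> word w * 0"
    using assms v by (intro lpa_eq_mult_left vertex_mult_gen_eq_0) auto
  finally show ?thesis by simp
qed

lemma ghost_mult_edge: "e \<in> arcs G \<Longrightarrow> gen (Ghost e) * gen (Edge e) \<approx> gen (Vertex (head G e))"
  using lpa_relations_in_ideal[OF lpa_relations.CK1[of e G e]] by (simp add: lpa_eq_def)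

text \<open>At a vertex that emits exactly one edge, the sum in (CK2) has one term. Together with (CK1) this makes
  \<open>e\<close> and \<open>e\<^sup>*\<close> inverse to each other, and it is the reason why the algebra of a cycle has Laurent
  polynomials as coefficients.\<close>
lemma edge_mult_ghost:
  assumes "out_arcs G v = {e}" shows "gen (Edge e) * gen (Ghost e) \<approx> gen (Vertex v)"
proof -
  have "v \<in> verts G" using in_out_arcs_conv[of e G v] tail_in_verts[of e] unfolding assms by auto
  then show ?thesis
    using assms lpa_relations_in_ideal[OF lpa_relations.CK2[of v G]]
    by (intro lpa_eq_sym[of "gen (Vertex v)"]) (simp add: lpa_eq_def)
qed

end

section \<open>Disjoint cycles and reduced paths\<close>

text \<open>Each cycle is unrolled to its universal cover, a line with a vertex \<open>vtx i n\<close> for every integer \<open>n\<close>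
  and an edge \<open>arc i n\<close> from \<open>vtx i n\<close> to \<open>vtx i (n + 1)\<close>; positions that agree modulo the length \<open>c\<close>
  are identified. Unrolling keeps track of winding numbers: a path in a cycle is known up to
  reduction once the two ends of its lift are known.\<close>
locale disjoint_cycles =
  fixes E :: "('v, 'e) pre_digraph" and I :: "'i set" and c :: nat
    and vtx :: "'i \<Rightarrow> int \<Rightarrow> 'v" and arc :: "'i \<Rightarrow> int \<Rightarrow> 'e"
  assumes finite_I: "finite I" and c_pos: "0 < c"
    and verts_eq: "verts E = (\<Union>i\<in>I. range (vtx i))"
    and arcs_eq: "arcs E = (\<Union>i\<in>I. range (arc i))"
    and vtx_eq_iff: "\<lbrakk>i \<in> I; j \<in> I\<rbrakk> \<Longrightarrow>
          vtx i n = vtx j k \<longleftrightarrow> i = j \<and> n mod int c = k mod int c"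
    and arc_cong: "\<lbrakk>i \<in> I; n mod int c = k mod int c\<rbrakk> \<Longrightarrow> arc i n = arc i k"
    and tail_arc: "i \<in> I \<Longrightarrow> tail E (arc i n) = vtx i n"
    and head_arc: "i \<in> I \<Longrightarrow> head E (arc i n) = vtx i (n + 1)"

sublocale disjoint_cycles \<subseteq> wf_digraph E
proof
  show "tail E e \<in> verts E" "head E e \<in> verts E" if "e \<in> arcs E" for e
    using that unfolding verts_eq arcs_eq by (auto simp: tail_arc head_arc intro!: UN_I rangeI)
qed

context disjoint_cycles
begin

notation lpa_eq (infix "\<approx>" 50)

lemma vtx_in_verts [simp]: "i \<in> I \<Longrightarrow> vtx i n \<in> verts E"
  and arc_in_arcs [simp]: "i \<in> I \<Longrightarrow> arc i n \<in> arcs E"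
  by (auto simp: verts_eq arcs_eq)

lemma tail_eq_vtx_iff: "\<lbrakk>i \<in> I; e \<in> arcs E\<rbrakk> \<Longrightarrow> tail E e = vtx i n \<longleftrightarrow> e = arc i n"
  by (auto simp: arcs_eq tail_arc vtx_eq_iff intro: arc_cong)

lemma head_eq_vtx_iff:
  assumes "i \<in> I" "e \<in> arcs E" shows "head E e = vtx i n \<longleftrightarrow> e = arc i (n - 1)"
proof
  assume h: "head E e = vtx i n"
  from assms obtain j k where j: "j \<in> I" "e = arc j k" by (auto simp: arcs_eq)
  with h assms have "j = i" "(k + 1) mod int c = n mod int c"
    by (auto simp: head_arc vtx_eq_iff)
  from this(2) have "k mod int c = (n - 1) mod int c"
    using mod_diff_cong[of "k + 1" "int c" n 1 1] by simp
  then show "e = arc i (n - 1)" using j \<open>j = i\<close> by (auto intro: arc_cong)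
qed (use assms in \<open>simp add: head_arc\<close>)

lemma out_arcs_vtx: "i \<in> I \<Longrightarrow> out_arcs E (vtx i n) = {arc i n}"
  by (auto simp: out_arcs_def tail_eq_vtx_iff)

text \<open>How a generator moves a point on the line that covers the \<open>i\<close>-th cycle, if it can be read there at
  all. A ghost edge moves the point back.\<close>
fun step :: "'i \<Rightarrow> ('v, 'e) lpa_gen \<Rightarrow> int \<Rightarrow> int option" where
  "step i (Vertex v) n = (if v = vtx i n then Some n else None)"
| "step i (Edge e) n = (if e = arc i n then Some (n + 1) else None)"
| "step i (Ghost e) n = (if e = arc i (n - 1) then Some (n - 1) else None)"

fun run :: "'i \<Rightarrow> ('v, 'e) lpa_gen list \<Rightarrow> int \<Rightarrow> int option" where
  "run i [] n = Some n"
| "run i (x # w) n = Option.bind (step i x n) (run i w)"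

lemma run_append: "run i (u @ w) n = Option.bind (run i u n) (run i w)"
  by (induction u arbitrary: n) (auto split: Option.bind_split)

lemma step_eq_None_iff:
  assumes "i \<in> I" "x \<in> lpa_gens E" shows "step i x n = None \<longleftrightarrow> gen_src x \<noteq> vtx i n"
  using assms by (cases x) (auto simp: tail_eq_vtx_iff head_eq_vtx_iff)

text \<open>Deck transformations commute with the action of words. This periodicity makes the infinite matrix of
  a word on positions into a \<open>c \<times> c\<close> matrix over Laurent polynomials.\<close>
lemma run_shift:
  assumes "i \<in> I"
  shows "run i w (n + int c * k) = map_option (\<lambda>m. m + int c * k) (run i w n)"
proof (induction w arbitrary: n)
  case (Cons x w)
  have v: "vtx i (n + int c * k) = vtx i n" for n
    using assms by (simp add: vtx_eq_iff)
  have a: "arc i (n + int c * k) = arc i n" for n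
    using assms by (intro arc_cong) auto
  have "step i x (n + int c * k) = map_option (\<lambda>m. m + int c * k) (step i x n)"
    using v a[of n] a[of "n - 1"] by (cases x) (simp_all add: algebra_simps)
  then show ?case
    by (cases "step i x n") (simp_all add: Cons.IH)
qed simp

text \<open>The reduced word from position \<open>a\<close> to position \<open>n\<close>. It starts with a vertex, so that it is nonempty
  even if \<open>a = n\<close>.\<close>
definition path :: "'i \<Rightarrow> int \<Rightarrow> int \<Rightarrow> ('v, 'e) lpa_gen list" where
  "path i a n = Vertex (vtx i a) #
     (if a \<le> n then map (\<lambda>k. Edge (arc i k)) [a..n - 1]
      else map (\<lambda>k. Ghost (arc i k)) (rev [n..a - 1]))"

lemma path_self: "path i a a = [Vertex (vtx i a)]"
  by (simp add: path_def)

lemma path_up: "a \<le> n \<Longrightarrow> path i a (n + 1) = path i a n @ [Edge (arc i n)]"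
  by (simp add: path_def upto_rec2)

lemma path_down: "n \<le> a \<Longrightarrow> path i a (n - 1) = path i a n @ [Ghost (arc i (n - 1))]"
  by (auto simp: path_def upto_rec1[of "n - 1"])

lemma path_neq_Nil [simp]: "path i a n \<noteq> []"
  by (simp add: path_def)

lemma path_in_lists [simp]: "i \<in> I \<Longrightarrow> path i a n \<in> lists (lpa_gens E)"
  by (auto simp: path_def)

lemma gen_tgt_path: "i \<in> I \<Longrightarrow> gen_tgt (last (path i a n)) = vtx i n"
  using path_up[of a "n - 1" i] path_down[of "n + 1" a i]
  by (cases n a rule: linorder_cases) (simp_all add: path_self head_arc tail_arc)

text \<open>A reduced path can be read at every position over its first vertex and moves that position by its
  length. Where the first vertex differs, reading fails at once.\<close>
lemma run_path:
  assumes "i \<in> I" "j \<in> I"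
  shows "run j (path i a n) b = (if vtx i a = vtx j b then Some (n + (b - a)) else None)"
proof -
  have "run j (path i a n) b = Some (n + (b - a))" if eq: "vtx i a = vtx j b"
  proof -
    have [simp]: "j = i" and ab: "b mod int c = a mod int c"
      using eq assms by (auto simp: vtx_eq_iff)
    have arc: "arc i (k + (b - a)) = arc i k" for k
    proof (rule arc_cong)
      show "(k + (b - a)) mod int c = k mod int c"
        using mod_add_cong[OF refl ab, of "k - a"] by (simp add: algebra_simps)
    qed fact
    have "a \<le> n \<or> n \<le> a" by linarith
    then show ?thesis
    proof
      assume "a \<le> n"
      then show ?thesis
      proof (induction n rule: int_ge_induct)
        case base then show ?case using eq by (simp add: path_self)
      next
        case (step m)
        then show ?case using arc[of m] by (simp add: path_up run_append)
      qed
    next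
      assume "n \<le> a"
      then show ?thesis
      proof (induction n rule: int_le_induct)
        case base then show ?case using eq by (simp add: path_self)
      next
        case (step m)
        then show ?case using arc[of "m - 1"]
          by (simp add: path_down run_append algebra_simps)
      qed
    qed
  qed
  then show ?thesis by (auto simp: path_def)
qed

text \<open>Reduced paths are closed under right multiplication by generators, up to congruence. A generator that
  points away from \<open>a\<close> lengthens the path, one that points towards \<open>a\<close> cancels the last letter by
  (CK1) or (CK2), and one that starts at another vertex gives \<open>0\<close>.\<close>
lemma path_mult_gen:
  assumes i: "i \<in> I" and x: "x \<in> lpa_gens E"
  shows "word (path i a n) * gen x \<approx>
    (case step i x n of None \<Rightarrow> 0 | Some m \<Rightarrow> word (path i a m))"
proof (cases "step i x n")
  case None
  then have "gen_src x \<noteq> vtx i n" using step_eq_None_iff[OF assms] by simp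
  then have "word (path i a n) * gen x \<approx> 0"
    using assms by (intro word_mult_gen_eq_0) (auto simp: gen_tgt_path)
  then show ?thesis using None by simp
next
  case (Some m)
  have end_vertex: "word (path i a k) * gen (Vertex (vtx i k)) \<approx> word (path i a k)" for k
    using word_end_vertex[of "path i a k"] i by (simp add: gen_tgt_path)
  have "word (path i a n) * gen x \<approx> word (path i a m)"
  proof (cases x)
    case (Vertex v)
    then show ?thesis using Some end_vertex[of n] by (auto split: if_splits)
  next
    case (Edge e)
    then have e: "e = arc i n" "m = n + 1" using Some by (auto split: if_splits)
    show ?thesis
    proof (cases "a \<le> n")
      case True
      then show ?thesis using Edge e by (simp add: path_up word_append)
    next
      case False
      then have "path i a n = path i a (n + 1) @ [Ghost (arc i n)]"
        using path_down[of "n + 1" a i] by simp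
      then have "word (path i a n) * gen x =
          word (path i a (n + 1)) * (gen (Ghost (arc i n)) * gen (Edge (arc i n)))"
        using Edge e by (simp add: word_append mult.assoc)
      also have "\<dots> \<approx> word (path i a (n + 1)) * gen (Vertex (vtx i (n + 1)))"
        using i ghost_mult_edge[of "arc i n"] by (intro lpa_eq_mult_left) (auto simp: head_arc)
      also note end_vertex
      finally show ?thesis using e by simp
    qed
  next
    case (Ghost e)
    then have e: "e = arc i (n - 1)" "m = n - 1" using Some by (auto split: if_splits)
    show ?thesis
    proof (cases "n \<le> a")
      case True
      then show ?thesis using Ghost e by (simp add: path_down word_append)
    next
      case False
      then have "path i a n = path i a (n - 1) @ [Edge (arc i (n - 1))]"
        using path_up[of a "n - 1" i] by simp
      then have "word (path i a n) * gen x =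
          word (path i a (n - 1)) * (gen (Edge (arc i (n - 1))) * gen (Ghost (arc i (n - 1))))"
        using Ghost e by (simp add: word_append mult.assoc)
      also have "\<dots> \<approx> word (path i a (n - 1)) * gen (Vertex (vtx i (n - 1)))"
        using i by (intro lpa_eq_mult_left edge_mult_ghost out_arcs_vtx) auto
      also note end_vertex
      finally show ?thesis using e by simp
    qed
  qed
  then show ?thesis using Some by simp
qed

text \<open>A nonempty word that is not zero in the algebra acts from one residue class of positions in one
  cycle, so the sum has at most one nonzero term. The empty word yields the sum of all vertices, which
  makes the recursion for \<open>w @ [x]\<close> start correctly.\<close>
definition normal_form :: "('v, 'e) lpa_gen list \<Rightarrow> ('v, 'e) lpa_gen list \<Rightarrow>\<^sub>0 'k::field" where
  "normal_form w = (\<Sum>i\<in>I. \<Sum>a<c.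
     case run i w (int a) of None \<Rightarrow> 0 | Some n \<Rightarrow> word (path i (int a) n))"

lemma normal_form_mult_gen:
  assumes "x \<in> lpa_gens E"
  shows "normal_form w * gen x \<approx> normal_form (w @ [x])"
  unfolding normal_form_def sum_distrib_right
proof (intro lpa_eq_sum)
  fix i a assume "i \<in> I"
  have "run i [x] n = step i x n" for n
    by (cases "step i x n") simp_all
  then show "(case run i w (int a) of None \<Rightarrow> 0 | Some n \<Rightarrow> word (path i (int a) n)) * gen x \<approx>
      (case run i (w @ [x]) (int a) of None \<Rightarrow> 0 | Some n \<Rightarrow> word (path i (int a) n))"
    using path_mult_gen[OF \<open>i \<in> I\<close> assms]
    by (cases "run i w (int a)") (simp_all add: run_append)
qed

text \<open>Of all the vertices, only the one where \<open>x\<close> starts does not annihilate \<open>x\<close> from the left.\<close>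
lemma local_unit:
  assumes "x \<in> lpa_gens E" shows "normal_form [] * gen x \<approx> gen x"
proof -
  from gen_ends_in_verts(1)[OF assms] obtain j n where j: "j \<in> I" "gen_src x = vtx j n"
    by (auto simp: verts_eq)
  define b where "b = nat (n mod int c)"
  have b: "b < c" "int b = n mod int c" using c_pos by (auto simp: b_def nat_less_iff)
  have "normal_form [] * gen x = (\<Sum>i\<in>I. \<Sum>a<c. gen (Vertex (vtx i (int a))) * gen x)"
    by (simp add: normal_form_def sum_distrib_right path_self)
  also have "\<dots> \<approx> (\<Sum>i\<in>I. \<Sum>a<c. if i = j then if a = b then gen x else 0 else 0)"
  proof (intro lpa_eq_sum)
    fix i a assume i: "i \<in> I" and a: "a \<in> {..<c}"
    have "vtx i (int a) = gen_src x \<longleftrightarrow> i = j \<and> a = b"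
      using i a j b by (auto simp: vtx_eq_iff)
    then show "gen (Vertex (vtx i (int a))) * gen x \<approx>
        (if i = j then if a = b then gen x else 0 else 0)"
      using i assms gen_src_left[OF assms] vertex_mult_gen_eq_0[of "vtx i (int a)" x] by auto
  qed
  also have "\<dots> = (\<Sum>i\<in>I. if i = j then gen x else 0)"
    using b(1) by (intro sum.cong) auto
  also have "\<dots> = gen x"
    using j(1) finite_I by simp
  finally show ?thesis .
qed

text \<open>Induction on the last letter: the sum of all vertices is a left unit for the first letter, and each
  further letter acts on the reduced paths that have been reached.\<close>
lemma word_eq_normal_form:
  assumes "w \<in> lists (lpa_gens E)" "w \<noteq> []"
  shows "(word w :: ('v, 'e) lpa_gen list \<Rightarrow>\<^sub>0 'k::field) \<approx> normal_form w"
  using assms(2,1)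
proof (induction w rule: rev_nonempty_induct)
  case (single x)
  then have "x \<in> lpa_gens E" by simp
  from lpa_eq_trans[OF lpa_eq_sym[OF local_unit] normal_form_mult_gen, OF this this]
  show ?case by simp
next
  case (snoc x w)
  then have "word w * gen x \<approx> (normal_form w :: _ \<Rightarrow>\<^sub>0 'k) * gen x"
    by (intro lpa_eq_mult_right) auto
  also have "\<dots> \<approx> normal_form (w @ [x])"
    using snoc by (intro normal_form_mult_gen) auto
  finally show ?case by (simp add: word_append)
qed

section \<open>The matrix representation\<close>

text \<open>Write a position as \<open>n = c q + b\<close> with \<open>0 \<le> b < c\<close>. A word that moves \<open>a\<close> to \<open>n\<close> contributes the
  monomial \<open>x\<^sup>q\<close> at the matrix entry \<open>(a, b)\<close>: the entry records the vertex and the exponent the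
  winding number.\<close>
definition entry :: "'i \<Rightarrow> nat \<Rightarrow> nat \<Rightarrow> ('v, 'e) lpa_gen list \<Rightarrow> 'k::field laurent_poly" where
  "entry i a b w = (case run i w (int a) of None \<Rightarrow> 0
     | Some n \<Rightarrow> if n mod int c = int b then Poly_Mapping.single (n div int c) 1 else 0)"

text \<open>The word \<open>u\<close> moves \<open>a\<close> to a single position \<open>n = k + c q\<close>, so only the summand \<open>k\<close> survives; by
  periodicity, \<open>w\<close> acts at \<open>n\<close> as it does at \<open>k\<close>, with the exponent raised by \<open>q\<close>.\<close>
lemma entry_mult:
  assumes "i \<in> I"
  shows "(entry i a b (u @ w) :: 'k::field laurent_poly) = (\<Sum>k<c. entry i a k u * entry i k b w)"
proof (cases "run i u (int a)")
  case None
  then show ?thesis by (simp add: entry_def run_append)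
next
  case (Some n)
  define k where "k = nat (n mod int c)"
  define q where "q = n div int c"
  have k: "k < c" "int k = n mod int c" using c_pos by (auto simp: k_def nat_less_iff)
  have n: "n = int k + int c * q" using k by (simp add: q_def)
  have "(\<Sum>l<c. entry i a l u * entry i l b w) =
      (\<Sum>l<c. if l = k then Poly_Mapping.single q 1 * entry i k b w else 0 :: 'k laurent_poly)"
    using Some k by (intro sum.cong) (auto simp: entry_def q_def)
  also have "\<dots> = Poly_Mapping.single q 1 * entry i k b w"
    using k(1) by simp
  also have "\<dots> = entry i a b (u @ w)"
  proof (cases "run i w (int k)")
    case None
    then show ?thesis
      using run_shift[OF assms, of w "int k" q] Some n by (simp add: entry_def run_append)
  next
    case (Some m)
    have "run i (u @ w) (int a) = Some (m + int c * q)"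
      using run_shift[OF assms, of w "int k" q] Some \<open>run i u (int a) = Some n\<close> n
      by (simp add: run_append)
    moreover have "(m + int c * q) div int c = q + m div int c"
      using c_pos by simp
    ultimately show ?thesis
      using Some by (simp add: entry_def mult_single)
  qed
  finally show ?thesis by simp
qed

text \<open>The entry \<open>(a, b)\<close> of the matrix over the \<open>i\<close>-th cycle by which a polynomial is represented.\<close>
definition rep ::
    "'i \<Rightarrow> nat \<Rightarrow> nat \<Rightarrow> (('v, 'e) lpa_gen list \<Rightarrow>\<^sub>0 'k::field) \<Rightarrow> 'k laurent_poly" where
  "rep i a b = lin_ext (entry i a b)"

lemma rep_word: "rep i a b (word w) = entry i a b w"
  by (simp add: rep_def)

lemma rep_mult:
  assumes "i \<in> I" shows "rep i a b (p * q) = (\<Sum>k<c. rep i a k p * rep i k b q)"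
  unfolding rep_def by (rule lin_ext_matrix_mult) (simp add: plus_list_def entry_mult assms)

lemma rep_simps:
  "rep i a b 0 = 0" "rep i a b (p + q) = rep i a b p + rep i a b q"
  "rep i a b (p - q) = rep i a b p - rep i a b q" "rep i a b (sum f A) = (\<Sum>x\<in>A. rep i a b (f x))"
  "rep i a b (scaled d p) = scaled d (rep i a b p)"
  by (simp_all add: rep_def lin_ext_add lin_ext_diff lin_ext_sum lin_ext_scaled)

definition annihilator :: "(('v, 'e) lpa_gen list \<Rightarrow>\<^sub>0 'k::field) set" where
  "annihilator = {p \<in> carrier (free_algebra (lpa_gens E)). \<forall>i\<in>I. \<forall>a<c. \<forall>b<c. rep i a b p = 0}"

text \<open>The common kernel of the matrix representations. That it is an ideal reduces the vanishing of the
  representations on the ideal of relations to the relations themselves.\<close>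
lemma ideal_annihilator:
  "ideal (annihilator :: (('v, 'e) lpa_gen list \<Rightarrow>\<^sub>0 'k::field) set) (free_algebra (lpa_gens E))"
proof -
  let ?F = "free_algebra (lpa_gens E) :: ('k, ('v, 'e) lpa_gen list \<Rightarrow>\<^sub>0 'k) module"
  let ?N = "annihilator :: (('v, 'e) lpa_gen list \<Rightarrow>\<^sub>0 'k) set"
  interpret F: ring ?F by (rule ring_free_algebra)
  have add: "p + q \<in> ?N" if "p \<in> ?N" "q \<in> ?N" for p q
    using that by (auto simp: annihilator_def rep_simps free_algebra_closed)
  have mult: "r * p \<in> ?N" "p * r \<in> ?N" if "p \<in> ?N" "r \<in> carrier ?F" for p r
    using that by (auto simp: annihilator_def rep_mult free_algebra_closed)
  have zero: "0 \<in> ?N"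
    using F.zero_closed by (auto simp: annihilator_def rep_simps free_algebra_ops)
  have inv: "\<ominus>\<^bsub>?F\<^esub> p \<in> ?N" if "p \<in> ?N" for p
  proof -
    have p: "p \<in> carrier ?F" using that by (simp add: annihilator_def)
    then have "\<ominus>\<^bsub>?F\<^esub> p = (\<ominus>\<^bsub>?F\<^esub> \<one>\<^bsub>?F\<^esub>) \<otimes>\<^bsub>?F\<^esub> p"
      by (simp add: F.l_minus)
    then show ?thesis
      using mult(1)[OF that, of "\<ominus>\<^bsub>?F\<^esub> \<one>\<^bsub>?F\<^esub>"] by (simp add: free_algebra_ops(1))
  qed
  have "?N \<subseteq> carrier ?F" by (auto simp: annihilator_def)
  then have "subgroup ?N (add_monoid ?F)"
    using add zero inv
    by (intro group.subgroupI[OF F.a_group])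
      (auto simp: free_algebra_ops a_inv_def)
  then show ?thesis
    using mult by (intro idealI F.ring_axioms) (simp_all add: free_algebra_ops)
qed

lemma vtx_eq_iff_arc_eq: "\<lbrakk>i \<in> I; j \<in> I\<rbrakk> \<Longrightarrow> vtx j n = vtx i k \<longleftrightarrow> arc j n = arc i k"
  using tail_eq_vtx_iff[of i "arc j n" k] by (simp add: tail_arc)

text \<open>The two sides of each relation move positions in the same way.\<close>
lemma lpa_relations_annihilated:
  assumes "p \<in> lpa_relations E" "i \<in> I"
  shows "rep i a b (p :: ('v, 'e) lpa_gen list \<Rightarrow>\<^sub>0 'k::field) = 0"
proof -
  have mult: "gen x * gen y = (word [x, y] :: ('v, 'e) lpa_gen list \<Rightarrow>\<^sub>0 'k)" for x y
    by (simp add: mult_single plus_list_def)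
  have rep: "rep i a b (word u - (if P then word w else 0) :: ('v, 'e) lpa_gen list \<Rightarrow>\<^sub>0 'k) = 0"
    if "run i u (int a) = (if P then run i w (int a) else None)" for u w P
    using that by (auto simp: rep_simps rep_word entry_def)
  have rep': "rep i a b (word u - word w :: ('v, 'e) lpa_gen list \<Rightarrow>\<^sub>0 'k) = 0"
    if "run i u (int a) = run i w (int a)" for u w
    using that by (auto simp: rep_simps rep_word entry_def)
  from assms(1) show ?thesis
  proof cases
    case (V v w)
    show ?thesis unfolding V mult by (rule rep) auto
  next
    case (E1_source e)
    then show ?thesis unfolding E1_source mult
      using assms(2) by (intro rep') (auto simp: tail_eq_vtx_iff)
  next
    case (E1_range e)
    then show ?thesis unfolding E1_range mult
      using assms(2) by (intro rep') (auto simp: head_eq_vtx_iff)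
  next
    case (E2_range e)
    then show ?thesis unfolding E2_range mult
      using assms(2) by (intro rep') (auto simp: head_eq_vtx_iff)
  next
    case (E2_source e)
    then show ?thesis unfolding E2_source mult
      using assms(2) by (intro rep') (auto simp: tail_eq_vtx_iff)
  next
    case (CK1 e f)
    then show ?thesis unfolding CK1 mult
      using assms(2) by (intro rep) (auto simp: head_eq_vtx_iff)
  next
    case (CK2 v)
    from CK2(2) obtain j n where v: "j \<in> I" "v = vtx j n" by (auto simp: verts_eq)
    show ?thesis unfolding CK2(1) v(2) out_arcs_vtx[OF v(1)] mult sum.insert_remove[OF finite.emptyI]
      using assms(2) v(1) by (auto intro!: rep' simp: vtx_eq_iff_arc_eq)
  qed
qed

lemma rep_lpa_ideal:
  assumes "p \<in> lpa_ideal E" "i \<in> I" "a < c" "b < c" shows "rep i a b (p :: _ \<Rightarrow>\<^sub>0 'k::field) = 0"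
proof -
  have "lpa_relations E \<subseteq> (annihilator :: (('v, 'e) lpa_gen list \<Rightarrow>\<^sub>0 'k) set)"
    using lpa_relations_subset[OF wf_digraph_axioms]
    by (auto simp: annihilator_def lpa_relations_annihilated)
  then have "lpa_ideal E \<subseteq> (annihilator :: (('v, 'e) lpa_gen list \<Rightarrow>\<^sub>0 'k) set)"
    unfolding lpa_ideal_def
    by (intro ring.genideal_minimal ring_free_algebra ideal_annihilator)
  then show ?thesis using assms by (auto simp: annihilator_def)
qed

text \<open>A linear preimage of the matrices over the \<open>i\<close>-th cycle with one nonzero entry: the monomial \<open>x\<^sup>k\<close> at
  \<open>(a, b)\<close> lifts to the reduced path from \<open>a\<close> to \<open>c k + b\<close>.\<close>
definition lift :: "'i \<Rightarrow> nat \<Rightarrow> nat \<Rightarrow> 'k::field laurent_poly \<Rightarrow> (('v, 'e) lpa_gen list \<Rightarrow>\<^sub>0 'k)" where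
  "lift i a b = lin_ext (\<lambda>k. word (path i (int a) (int c * k + int b)))"

lemma sum_lift_entry:
  "(\<Sum>b<c. lift i a b (entry i a b w) :: ('v, 'e) lpa_gen list \<Rightarrow>\<^sub>0 'k::field) =
     (case run i w (int a) of None \<Rightarrow> 0 | Some n \<Rightarrow> word (path i (int a) n))"
proof (cases "run i w (int a)")
  case None
  then show ?thesis by (simp add: entry_def lift_def)
next
  case (Some n)
  define r where "r = nat (n mod int c)"
  have r: "r < c" "int r = n mod int c" using c_pos by (auto simp: r_def nat_less_iff)
  have "(\<Sum>b<c. lift i a b (entry i a b w)) =
      (\<Sum>b<c. if b = r then word (path i (int a) n) else (0 :: _ \<Rightarrow>\<^sub>0 'k))"
    using Some r by (intro sum.cong) (auto simp: entry_def lift_def)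
  also have "\<dots> = word (path i (int a) n)"
    using r(1) by simp
  finally show ?thesis using Some by simp
qed

text \<open>Injectivity. Modulo the relations, \<open>p\<close> equals its normal form, and the normal form is the lift of the
  matrices of \<open>p\<close>; hence it vanishes with them. The constant term of \<open>p\<close> must vanish because the empty
  word is not congruent to its normal form.\<close>
lemma rep_eq_0_imp_in_lpa_ideal:
  assumes p: "p \<in> carrier (free_algebra (lpa_gens E))" "Poly_Mapping.lookup p [] = 0"
    and rep: "\<And>i a b. i \<in> I \<Longrightarrow> a < c \<Longrightarrow> b < c \<Longrightarrow> rep i a b p = 0"
  shows "p \<in> lpa_ideal E"
proof -
  \<comment> \<open>The inner sum over \<open>b\<close> has one term and undoes the division of the end position by \<open>c\<close>.\<close>
  have normal_form_eq: "normal_form = (\<lambda>w. \<Sum>i\<in>I. \<Sum>a<c. \<Sum>b<c. lift i a b (entry i a b w))"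
    by (simp add: fun_eq_iff normal_form_def sum_lift_entry)
  have "p = (\<Sum>w\<in>Poly_Mapping.keys p. scaled (Poly_Mapping.lookup p w) (word w))"
    using lin_ext_single_1[of p] by (simp add: lin_ext_def)
  also have "\<dots> \<approx> (\<Sum>w\<in>Poly_Mapping.keys p. scaled (Poly_Mapping.lookup p w) (normal_form w))"
  proof (intro lpa_eq_sum lpa_eq_scaled word_eq_normal_form)
    fix w assume "w \<in> Poly_Mapping.keys p"
    then show "w \<in> lists (lpa_gens E)" "w \<noteq> []"
      using p by (auto simp: carrier_free_algebra in_keys_iff)
  qed
  also have "\<dots> = lin_ext normal_form p"
    by (simp add: lin_ext_def)
  also have "\<dots> = (\<Sum>i\<in>I. \<Sum>a<c. \<Sum>b<c. lift i a b (rep i a b p))"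
    by (simp add: normal_form_eq lin_ext_fun_sum lift_def rep_def lin_ext_lin_ext)
  also have "\<dots> = 0"
    using rep by (simp add: lift_def)
  finally show ?thesis by (simp add: lpa_eq_def)
qed

text \<open>The lifts are right inverse to the representation, which gives surjectivity: the path from \<open>a\<close> to \<open>n\<close>
  can be read only from \<open>a\<close>, among the positions below \<open>c\<close> in all cycles.\<close>
lemma rep_lift:
  assumes "i \<in> I" "j \<in> I" "a < c" "b < c" "a' < c" "b' < c"
  shows "rep j a' b' (lift i a b (f :: 'k::field laurent_poly)) = (if j = i \<and> a' = a \<and> b' = b then f else 0)"
proof -
  have "entry j a' b' (path i (int a) (int c * k + int b)) =
      (if j = i \<and> a' = a \<and> b' = b then Poly_Mapping.single k (1 :: 'k) else 0)" for k
    using assms by (auto simp: entry_def run_path vtx_eq_iff)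
  then show ?thesis
    unfolding rep_def lift_def lin_ext_lin_ext
    by (auto simp: lin_ext_single_1) (simp_all add: lin_ext_def)
qed

section \<open>The isomorphism for disjoint cycles\<close>

definition to_matrices ::
    "(('v, 'e) lpa_gen list \<Rightarrow>\<^sub>0 'k::field) \<Rightarrow> 'i \<Rightarrow> 'k laurent_poly mat" where
  "to_matrices p = (\<lambda>i\<in>I. mat c c (\<lambda>(a, b). rep i a b p))"

lemma to_matrices_eq_iff:
  "to_matrices p = to_matrices q \<longleftrightarrow> (\<forall>i\<in>I. \<forall>a<c. \<forall>b<c. rep i a b p = rep i a b q)"
proof
  assume eq: "to_matrices p = to_matrices q"
  have "rep i a b p = to_matrices p i $$ (a, b)" "rep i a b q = to_matrices q i $$ (a, b)"
    if "i \<in> I" "a < c" "b < c" for i a b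
    using that by (simp_all add: to_matrices_def)
  then show "\<forall>i\<in>I. \<forall>a<c. \<forall>b<c. rep i a b p = rep i a b q"
    using eq by simp
next
  assume "\<forall>i\<in>I. \<forall>a<c. \<forall>b<c. rep i a b p = rep i a b q"
  then show "to_matrices p = to_matrices q"
    unfolding to_matrices_def by (intro restrict_ext eq_matI) auto
qed

lemma to_matrices_mult:
  "to_matrices (p * q) = (\<lambda>i\<in>I. to_matrices p i * to_matrices q i)"
  unfolding to_matrices_def
  by (intro restrict_ext eq_matI) (auto simp: rep_mult scalar_prod_def lessThan_atLeast0)

lemma to_matrices_add:
  "to_matrices (p + q) = (\<lambda>i\<in>I. to_matrices p i + to_matrices q i)"
  unfolding to_matrices_def by (intro restrict_ext eq_matI) (auto simp: rep_simps)

lemma to_matrices_scaled: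
  "to_matrices (scaled d p) = (\<lambda>i\<in>I. map_mat (scaled d) (to_matrices p i))"
  unfolding to_matrices_def by (intro restrict_ext eq_matI) (auto simp: rep_simps)

lemma finite_verts: "finite (verts E)"
proof -
  have "verts E \<subseteq> (\<lambda>(i, n). vtx i n) ` (I \<times> {0..<int c})"
  proof
    fix v assume "v \<in> verts E"
    then obtain i n where v: "i \<in> I" "v = vtx i n" by (auto simp: verts_eq)
    then have "v = vtx i (n mod int c)" by (simp add: vtx_eq_iff)
    then show "v \<in> (\<lambda>(i, n). vtx i n) ` (I \<times> {0..<int c})"
      using v(1) c_pos by (intro image_eqI[of _ _ "(i, n mod int c)"]) auto
  qed
  then show ?thesis using finite_I by (auto intro: finite_subset)
qed

text \<open>The sum of the vertices acts as the identity because each position carries exactly one vertex.\<close>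
lemma to_matrices_one:
  "to_matrices (\<Sum>v\<in>verts E. gen (Vertex v) :: _ \<Rightarrow>\<^sub>0 'k::field) = (\<lambda>i\<in>I. 1\<^sub>m c)"
proof -
  have "rep i a b (\<Sum>v\<in>verts E. gen (Vertex v)) = (if a = b then 1 else 0 :: 'k laurent_poly)"
    if "i \<in> I" "a < c" "b < c" for i a b
  proof -
    have "entry i a b [Vertex v] =
        (if v = vtx i (int a) then if a = b then 1 else 0 else 0 :: 'k laurent_poly)" for v
      using that by (simp add: entry_def)
    then have "rep i a b (\<Sum>v\<in>verts E. gen (Vertex v)) =
        (\<Sum>v\<in>verts E. if v = vtx i (int a) then if a = b then 1 else 0 else 0 :: 'k laurent_poly)"
      by (simp add: rep_simps rep_word)
    then show ?thesis
      using that finite_verts by simp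
  qed
  then show ?thesis
    unfolding to_matrices_def by (intro restrict_ext eq_matI) auto
qed

lemma lift_nonunital:
  assumes "i \<in> I"
  shows "lift i a b f \<in> carrier (free_algebra (lpa_gens E))" "Poly_Mapping.lookup (lift i a b f) [] = 0"
proof -
  have "x \<in> lpa_gens E" if "x \<in> set (path i n k)" for x n k
    using path_in_lists[OF assms, of n k] that by auto
  then show "lift i a b f \<in> carrier (free_algebra (lpa_gens E))" "Poly_Mapping.lookup (lift i a b f) [] = 0"
    unfolding lift_def lin_ext_def carrier_free_algebra
    by (auto simp: lookup_sum lookup_single dest!: subsetD[OF keys_sum] split: if_splits)
qed

lemma sum_nonunital:
  assumes "\<And>x. x \<in> A \<Longrightarrow> f x \<in> carrier (free_algebra X) \<and> Poly_Mapping.lookup (f x) [] = 0"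
  shows "sum f A \<in> carrier (free_algebra X) \<and> Poly_Mapping.lookup (sum f A) [] = 0"
  using assms
  by (auto simp: lookup_sum carrier_free_algebra dest!: subsetD[OF keys_sum])

lemma to_matrices_surj:
  fixes f :: "'i \<Rightarrow> 'k::field laurent_poly mat"
  assumes "f \<in> (\<Pi>\<^sub>E i\<in>I. carrier_mat c c)"
  obtains p where "p \<in> carrier (free_algebra (lpa_gens E))" "Poly_Mapping.lookup p [] = 0"
    "to_matrices p = f"
proof
  let ?p = "\<Sum>i\<in>I. \<Sum>a<c. \<Sum>b<c. lift i a b (f i $$ (a, b))"
  have "?p \<in> carrier (free_algebra (lpa_gens E)) \<and> Poly_Mapping.lookup ?p [] = 0"
    by (intro sum_nonunital) (auto simp: lift_nonunital)
  then show "?p \<in> carrier (free_algebra (lpa_gens E))" "Poly_Mapping.lookup ?p [] = 0" by auto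
  have rep: "rep j a' b' ?p = f j $$ (a', b')" if "j \<in> I" "a' < c" "b' < c" for j a' b'
  proof -
    have b: "(\<Sum>b<c. if i = j \<and> a = a' \<and> b = b' then f i $$ (a, b) else 0) =
        (if i = j \<and> a = a' then f i $$ (a, b') else 0)" for i a
      using that by (cases "i = j \<and> a = a'") auto
    have a: "(\<Sum>a<c. if i = j \<and> a = a' then f i $$ (a, b') else 0) =
        (if i = j then f i $$ (a', b') else 0)" for i
      using that by (cases "i = j") auto
    have "rep j a' b' ?p = (\<Sum>i\<in>I. \<Sum>a<c. \<Sum>b<c.
        if i = j \<and> a = a' \<and> b = b' then f i $$ (a, b) else 0)"
      unfolding rep_simps using that by (intro sum.cong refl) (auto simp: rep_lift)
    also have "\<dots> = f j $$ (a', b')"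
      unfolding a b using that finite_I by simp
    finally show ?thesis .
  qed
  show "to_matrices ?p = f"
  proof
    fix i
    show "to_matrices ?p i = f i"
    proof (cases "i \<in> I")
      case True
      then have "f i \<in> carrier_mat c c" using assms by auto
      then show ?thesis using True rep by (intro eq_matI) (auto simp: to_matrices_def)
    next
      case False
      then show ?thesis using assms by (auto simp: to_matrices_def PiE_def extensional_def)
    qed
  qed
qed

text \<open>The matrices of \<open>p\<close> depend only on the class of \<open>p\<close> in the algebra (\<open>rep_lpa_ideal\<close>), they determine
  it (\<open>rep_eq_0_imp_in_lpa_ideal\<close>), and they can be prescribed (\<open>to_matrices_surj\<close>).\<close>
theorem leavitt_path_algebra_iso:
  "alg_isomorphic (leavitt_path_algebra TYPE('k::field) E)
     (alg_direct_sum I (\<lambda>_. laurent_mat_algebra TYPE('k) c))"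
proof -
  let ?F = "free_algebra (lpa_gens E) :: ('k, ('v, 'e) lpa_gen list \<Rightarrow>\<^sub>0 'k) module"
  let ?J = "lpa_ideal E :: (('v, 'e) lpa_gen list \<Rightarrow>\<^sub>0 'k) set"
  let ?L = "leavitt_path_algebra TYPE('k) E"
  let ?B = "alg_direct_sum I (\<lambda>_. laurent_mat_algebra TYPE('k) c)"
  define cls where "cls p = ?J +>\<^bsub>?F\<^esub> p" for p
  define h where "h X = to_matrices (SOME p. p \<in> X)" for X :: "(('v, 'e) lpa_gen list \<Rightarrow>\<^sub>0 'k) set"
  interpret J: ideal ?J ?F by (rule ideal_lpa_ideal)
  \<comment> \<open>The value does not depend on the representative, since the representations vanish on the ideal.\<close>
  have h: "h (cls p) = to_matrices p" for p
  proof -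
    have "p \<in> cls p" by (simp add: cls_def free_algebra_coset_mem lpa_ideal_closed)
    then have "(SOME q. q \<in> cls p) \<in> cls p" by (rule someI)
    then have "(SOME q. q \<in> cls p) - p \<in> ?J" by (simp add: cls_def free_algebra_coset_mem)
    then show ?thesis
      using rep_lpa_ideal[of "(SOME q. q \<in> cls p) - p"]
      by (simp add: h_def to_matrices_eq_iff rep_simps)
  qed
  have carrier_L: "carrier ?L = {cls p | p. p \<in> carrier ?F \<and> Poly_Mapping.lookup p [] = 0}"
    by (simp add: leavitt_path_algebra_def cls_def Let_def)
  have carrier_B: "carrier ?B = (\<Pi>\<^sub>E i\<in>I. carrier_mat c c)"
    using finite_I by (auto simp: alg_direct_sum_def laurent_mat_algebra_def ring_mat_def)
  have mult_L: "cls p \<otimes>\<^bsub>?L\<^esub> cls q = cls (p * q)" if "p \<in> carrier ?F" "q \<in> carrier ?F" for p q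
    using J.rcoset_mult_add[OF that]
    by (simp add: leavitt_path_algebra_def cls_def Let_def free_algebra_ops)
  have add_L: "cls p \<oplus>\<^bsub>?L\<^esub> cls q = cls (p + q)" if "p \<in> carrier ?F" "q \<in> carrier ?F" for p q
    using J.a_rcos_sum[OF that]
    by (simp add: leavitt_path_algebra_def cls_def Let_def free_algebra_ops)
  have smult_L: "d \<odot>\<^bsub>?L\<^esub> cls p = cls (scaled d p)" for d p
  proof -
    have "cls (scaled d q) = cls (scaled d p)" if "q \<in> cls p" for q
      using that unfolding cls_def free_algebra_coset_eq_iff[OF ideal_lpa_ideal]
      by (simp add: free_algebra_coset_mem lpa_ideal_closed flip: scaled_diff)
    moreover have "p \<in> cls p" by (simp add: cls_def free_algebra_coset_mem lpa_ideal_closed)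
    ultimately have "(\<Union>q\<in>cls p. cls (scaled d q)) = cls (scaled d p)" by blast
    then show ?thesis
      by (simp add: leavitt_path_algebra_def cls_def Let_def free_algebra_ops)
  qed
  have "h \<in> Ring.ring_hom ?L ?B"
  proof (rule ring_hom_memI)
    fix X assume "X \<in> carrier ?L"
    then obtain p where X: "X = cls p" by (auto simp: carrier_L)
    show "h X \<in> carrier ?B"
      unfolding X h carrier_B by (auto simp: to_matrices_def)
  next
    fix X Y assume "X \<in> carrier ?L" "Y \<in> carrier ?L"
    then obtain p q where X: "X = cls p" "p \<in> carrier ?F" and Y: "Y = cls q" "q \<in> carrier ?F"
      by (auto simp: carrier_L)
    show "h (X \<otimes>\<^bsub>?L\<^esub> Y) = h X \<otimes>\<^bsub>?B\<^esub> h Y"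
      using X Y by (simp add: mult_L h to_matrices_mult alg_direct_sum_def
          laurent_mat_algebra_def ring_mat_def)
    show "h (X \<oplus>\<^bsub>?L\<^esub> Y) = h X \<oplus>\<^bsub>?B\<^esub> h Y"
      using X Y by (simp add: add_L h to_matrices_add alg_direct_sum_def
          laurent_mat_algebra_def ring_mat_def)
  next
    have "\<one>\<^bsub>?L\<^esub> = cls (\<Sum>v\<in>verts E. gen (Vertex v))"
      by (simp add: leavitt_path_algebra_def cls_def Let_def)
    then show "h \<one>\<^bsub>?L\<^esub> = \<one>\<^bsub>?B\<^esub>"
      by (simp add: h to_matrices_one alg_direct_sum_def laurent_mat_algebra_def ring_mat_def)
  qed
  moreover have "bij_betw h (carrier ?L) (carrier ?B)"
  proof (rule bij_betw_imageI)
    show "inj_on h (carrier ?L)"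
    proof (rule inj_onI)
      fix X Y assume "X \<in> carrier ?L" "Y \<in> carrier ?L" and eq: "h X = h Y"
      then obtain p q where
        X: "X = cls p" "p \<in> carrier ?F" "Poly_Mapping.lookup p [] = 0" and
        Y: "Y = cls q" "q \<in> carrier ?F" "Poly_Mapping.lookup q [] = 0"
        by (auto simp: carrier_L)
      have "p - q \<in> ?J"
        using eq X Y by (intro rep_eq_0_imp_in_lpa_ideal)
          (auto simp: free_algebra_closed lookup_minus h to_matrices_eq_iff rep_simps)
      then show "X = Y"
        unfolding X Y cls_def free_algebra_coset_eq_iff[OF ideal_lpa_ideal] .
    qed
    show "h ` carrier ?L = carrier ?B"
    proof
      show "h ` carrier ?L \<subseteq> carrier ?B"
        using \<open>h \<in> Ring.ring_hom ?L ?B\<close> by (auto simp: Ring.ring_hom_def)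
      show "carrier ?B \<subseteq> h ` carrier ?L"
      proof
        fix f assume "f \<in> carrier ?B"
        then obtain p where "p \<in> carrier ?F" "Poly_Mapping.lookup p [] = 0" "to_matrices p = f"
          unfolding carrier_B by (rule to_matrices_surj)
        then have "cls p \<in> carrier ?L" "f = h (cls p)"
          by (auto simp: carrier_L h)
        then show "f \<in> h ` carrier ?L" by blast
      qed
    qed
  qed
  moreover have "h (d \<odot>\<^bsub>?L\<^esub> X) = d \<odot>\<^bsub>?B\<^esub> h X" if "X \<in> carrier ?L" for d X
  proof -
    from that obtain p where X: "X = cls p" by (auto simp: carrier_L)
    show ?thesis
      unfolding X smult_L h to_matrices_scaled
      by (simp add: alg_direct_sum_def laurent_mat_algebra_def ring_mat_def module.defs)
  qed
  ultimately show ?thesis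
    unfolding alg_isomorphic_def ring_iso_def by blast
qed

end

section \<open>Groups of exponent three\<close>

text \<open>In a group of exponent 3 the powers of \<open>x\<close> are \<open>1\<close>, \<open>x\<close> and \<open>x\<^sup>-\<^sup>1\<close>, and the last two differ if
  \<open>x \<noteq> 1\<close>, since otherwise \<open>x\<^sup>2 = 1 = x\<^sup>3\<close>.\<close>
lemma (in group) exponent_3:
  assumes "group_exponent G = 3" "x \<in> carrier G"
  shows "x [^] (2::int) = inv x" "x [^] (k::int) = x [^] (k mod 3)"
    "x \<noteq> \<one> \<Longrightarrow> inv x \<noteq> x"
proof -
  have "ord x dvd 3"
    using assms(1,2) dvd_Lcm[of "ord x" "ord ` carrier G"] by (simp add: group_exponent_def)
  then have "x [^] (3::nat) = \<one>"
    using assms(2) pow_eq_id by blast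
  then have x3: "x [^] (3::int) = \<one>"
    using int_pow_int[of G x 3] by simp
  have "x [^] (2::int) \<otimes> x = \<one>"
    using int_pow_mult[OF assms(2), of 2 1] x3 assms(2) by simp
  then show sq: "x [^] (2::int) = inv x"
    using assms(2) inv_equality by force
  have "x [^] k = x [^] (3 * (k div 3) + k mod 3)" by simp
  also have "\<dots> = (x [^] (3::int)) [^] (k div 3) \<otimes> x [^] (k mod 3)"
    using assms(2) by (simp only: int_pow_mult int_pow_pow)
  finally show "x [^] k = x [^] (k mod 3)"
    using assms(2) by (simp add: x3)
  show "inv x \<noteq> x" if "x \<noteq> \<one>"
  proof
    assume "inv x = x"
    then have "x \<otimes> x = \<one>" using r_inv[OF assms(2)] by simp
    moreover have "x [^] (2::int) = x \<otimes> x"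
      using int_pow_mult[OF assms(2), of 1 1] assms(2) by simp
    ultimately have "inv x = \<one>" using sq by simp
    then show False using \<open>inv x = x\<close> that by simp
  qed
qed

lemma (in group) arcs_punctured_power_digraph_exponent_3:
  assumes "group_exponent G = 3"
  shows "arcs (punctured_power_digraph G) = (\<lambda>x. (x, inv x)) ` (carrier G - {\<one>})"
proof -
  have "y = inv x" if xy: "x \<in> carrier G" "x \<noteq> y" "y \<noteq> \<one>" "y = x [^] (k::int)" for x y k
  proof -
    have "y = x [^] (k mod 3)" using exponent_3(2)[OF assms xy(1)] xy(4) by simp
    moreover have "k mod 3 = 0 \<or> k mod 3 = 1 \<or> k mod 3 = 2" by presburger
    ultimately show ?thesis
      using xy exponent_3(1)[OF assms xy(1)] by auto
  qed
  moreover have "\<exists>k::int. inv x = x [^] k" if "x \<in> carrier G" for x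
    using exponent_3(1)[OF assms that] by metis
  moreover have "x \<noteq> inv x" if "x \<in> carrier G" "x \<noteq> \<one>" for x
    using exponent_3(3)[OF assms that(1) that(2)] by simp
  ultimately show ?thesis
    by (fastforce simp: punctured_power_digraph_def power_digraph_def pre_digraph.del_vert_def)
qed

text \<open>Inversion without fixed points on the nonidentity elements splits them into pairs. The pairs partition
  a set with \<open>order G - 1\<close> elements, which determines their number.\<close>
lemma (in group) inverse_pairs:
  assumes "finite (carrier G)" "\<And>x. x \<in> carrier G \<Longrightarrow> x \<noteq> \<one> \<Longrightarrow> inv x \<noteq> x"
  obtains r :: "nat \<Rightarrow> 'a" where
    "\<And>i. i < (order G - 1) div 2 \<Longrightarrow> r i \<in> carrier G - {\<one>}"
    "carrier G - {\<one>} = (\<Union>i<(order G - 1) div 2. {r i, inv (r i)})"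
    "\<And>i j. i < (order G - 1) div 2 \<Longrightarrow> j < (order G - 1) div 2 \<Longrightarrow>
       {r i, inv (r i)} \<inter> {r j, inv (r j)} \<noteq> {} \<Longrightarrow> i = j"
proof -
  define V where "V = carrier G - {\<one>}"
  define P where "P = (\<lambda>x. {x, inv x}) ` V"
  have finV: "finite V" using assms(1) by (simp add: V_def)
  have inv_V: "inv x \<in> V" "inv (inv x) = x" if "x \<in> V" for x
    using that by (auto simp: V_def)
  have UP: "\<Union>P = V" using inv_V by (auto simp: P_def)
  have disj: "A = B" if "A \<in> P" "B \<in> P" "A \<inter> B \<noteq> {}" for A B
    using that by (auto simp: P_def V_def)
  have "2 * card P = card (\<Union>P)"
  proof (rule card_partition)
    fix A assume "A \<in> P"
    then obtain x where "A = {x, inv x}" "x \<noteq> inv x"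
      using assms(2) by (fastforce simp: P_def V_def)
    then show "card A = 2" by simp
  next
    show "A \<inter> B = {}" if "A \<in> P" "B \<in> P" "A \<noteq> B" for A B
      using disj that by blast
    show "finite P" "finite (\<Union>P)"
      using finV by (auto simp: UP) (simp add: P_def)
  qed
  also have "card (\<Union>P) = order G - 1"
    unfolding UP V_def order_def using assms(1) by simp
  finally have cardP: "card P = (order G - 1) div 2" by simp
  obtain h where h: "bij_betw h {..<card P} P"
    using ex_bij_betw_nat_finite[of P] finV by (auto simp: P_def lessThan_atLeast0)
  have "\<forall>i\<in>{..<card P}. \<exists>x. x \<in> V \<and> h i = {x, inv x}"
    using bij_betwE[OF h] by (auto simp: P_def)
  then obtain r where r: "\<And>i. i < card P \<Longrightarrow> r i \<in> V \<and> h i = {r i, inv (r i)}"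
    by (metis lessThan_iff)
  show thesis
  proof (rule that[of r, folded cardP V_def])
    show "r i \<in> V" if "i < card P" for i using r that by simp
    have "V = (\<Union>i<card P. h i)" using h UP by (auto simp: bij_betw_def)
    then show "V = (\<Union>i<card P. {r i, inv (r i)})" using r by simp
    show "i = j" if "i < card P" "j < card P" "{r i, inv (r i)} \<inter> {r j, inv (r j)} \<noteq> {}" for i j
    proof -
      have "h i \<in> P" "h j \<in> P" using that(1,2) bij_betwE[OF h] by auto
      moreover have "h i \<inter> h j \<noteq> {}" using that r[of i] r[of j] by auto
      ultimately have "h i = h j" by (rule disj)
      then show ?thesis using that h by (auto simp: bij_betw_def inj_on_def)
    qed
  qed
qed

theorem proposition1:
  fixes G :: "('a, 'b) monoid_scheme" and m :: nat
  assumes "group G" and "finite (carrier G)" and "order G = m" and "group_exponent G = 3"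
  shows "alg_isomorphic
           (leavitt_path_algebra TYPE('k::field) (punctured_power_digraph G))
           (alg_direct_sum {..<(m - 1) div 2} (\<lambda>_. laurent_mat_algebra TYPE('k) 2))"
proof -
  interpret group G by fact
  let ?E = "punctured_power_digraph G"
  note inv_neq = exponent_3(3)[OF assms(4)]
  obtain r where r: "\<And>i. i < (m - 1) div 2 \<Longrightarrow> r i \<in> carrier G - {\<one>\<^bsub>G\<^esub>}"
    "carrier G - {\<one>\<^bsub>G\<^esub>} = (\<Union>i<(m - 1) div 2. {r i, inv\<^bsub>G\<^esub> (r i)})"
    "\<And>i j. i < (m - 1) div 2 \<Longrightarrow> j < (m - 1) div 2 \<Longrightarrow>
       {r i, inv\<^bsub>G\<^esub> (r i)} \<inter> {r j, inv\<^bsub>G\<^esub> (r j)} \<noteq> {} \<Longrightarrow> i = j"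
    using inverse_pairs[OF assms(2) inv_neq] unfolding assms(3) by blast
  \<comment> \<open>The two elements of a pair alternate along the line that covers their cycle.\<close>
  define vtx where "vtx i n = (if even n then r i else inv\<^bsub>G\<^esub> (r i))" for i and n :: int
  define arc where "arc i n = (vtx i n, vtx i (n + 1))" for i n
  have range_vtx: "range (vtx i) = {r i, inv\<^bsub>G\<^esub> (r i)}" for i
  proof -
    have "r i = vtx i 0" "inv\<^bsub>G\<^esub> (r i) = vtx i 1" by (simp_all add: vtx_def)
    then have "{r i, inv\<^bsub>G\<^esub> (r i)} \<subseteq> range (vtx i)" by simp
    then show ?thesis by (auto simp: vtx_def)
  qed
  have verts: "carrier G - {\<one>\<^bsub>G\<^esub>} = (\<Union>i<(m - 1) div 2. range (vtx i))"
    using r(2) by (simp add: range_vtx)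
  have "disjoint_cycles ?E {..<(m - 1) div 2} 2 vtx arc"
  proof
    show "verts ?E = (\<Union>i<(m - 1) div 2. range (vtx i))"
      using verts by (simp add: punctured_power_digraph_def power_digraph_def pre_digraph.del_vert_def)
    have "inv\<^bsub>G\<^esub> (vtx i n) = vtx i (n + 1)" if "i < (m - 1) div 2" for i n
      using r(1)[OF that] by (simp add: vtx_def)
    then show "arcs ?E = (\<Union>i<(m - 1) div 2. range (arc i))"
      unfolding arcs_punctured_power_digraph_exponent_3[OF assms(4)] verts image_UN
      by (intro SUP_cong refl) (simp add: arc_def image_image)
    show "vtx i n = vtx j k \<longleftrightarrow> i = j \<and> n mod int 2 = k mod int 2"
      if "i \<in> {..<(m - 1) div 2}" "j \<in> {..<(m - 1) div 2}" for i j n k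
    proof -
      have "i = j" if "vtx i n = vtx j k"
        using r(3)[of i j] that \<open>i \<in> _\<close> \<open>j \<in> _\<close> by (force simp: vtx_def split: if_splits)
      moreover have "vtx i n = vtx i k \<longleftrightarrow> even n = even k"
        using inv_neq[of "r i"] r(1)[of i] \<open>i \<in> _\<close> by (auto simp: vtx_def)
      moreover have "even n = even k \<longleftrightarrow> n mod int 2 = k mod int 2"
        by (simp add: even_iff_mod_2_eq_zero) presburger
      ultimately show ?thesis by auto
    qed
    show "arc i n = arc i k" if "n mod int 2 = k mod int 2" for i n k
    proof -
      have "even n = even k" using that by simp presburger
      then show ?thesis by (simp add: arc_def vtx_def)
    qed
  qed (auto simp: arc_def punctured_power_digraph_def power_digraph_def pre_digraph.del_vert_def)
  then show ?thesis by (rule disjoint_cycles.leavitt_path_algebra_iso)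
qed

end
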